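(* Consider a semi-explicit pHDAE on $\mathcal X=\mathcal X_1\times\mathcal X_2$ with $E=\mathrm{diag}(E_{11},0),J,R,B$, $z=(z_1,z_2)$ and specified Hamiltonian $\mathcal H_1$. Let $\overline E_{11},\overline z_2$ be consistent discretizations of $E_{11},z_2$ with $\overline E_{11}$ pointwise invertible on $\mathcal X\times\mathcal X$, let $\overline\nabla\mathcal H_1$ be a discrete gradient of $\mathcal H_1$, and set $$\overline E=\begin{bmatrix}\overline E_{11}&0\\0&0\end{bmatrix},\qquad \overline z(x,x')=\begin{bmatrix}\overline E_{11}(x,x')^{-\top}\overline\nabla\mathcal H_1(x_1,x_1')\\ \overline z_2(x,x')\end{bmatrix}.$$ Fix consistent discretizations $\overline J,\overline R,\overline B$ of $J,R,B$, with $\overline J=-\overline J^\top$ and $\overline R=\overline R^\top\succeq0$ pointwise. Then the semi-explicit discrete gradient method applied with $\overline\nabla\mathcal H_1$ and the discrete gradient pair method applied with $(\overline E,\overline z)$ yield the same solution. That is, for all $h>0$, $x^k,x^{k+1}\in\mathcal X$ and $u^{k,k+1},y^{k,k+1}\in\mathbb R^m$, there is $z_1^{k,k+1}\in\mathbb R^{n_1}$ such that the equations of the semi-explicit discrete gradient method hold if and only if the equations of the discrete gradient pair method hold.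
   Context: A semi-explicit pHDAE is a system $E(x)\dot x=(J(x)-R(x))z(x)+B(x)u$, $y=B(x)^\top z(x)$, $x=(x_1,x_2)\in\mathcal X=\mathcal X_1\times\mathcal X_2$, where $\mathcal X_1\subseteq\mathbb R^{n_1}$ is open, $\mathcal X_2\subseteq\mathbb R^{n_2}$ is open and convex, $n=n_1+n_2$, $E,J,R\in C(\mathcal X,\mathbb R^{n,n})$, $B\in C(\mathcal X,\mathbb R^{n,m})$, $z=(z_1,z_2)\in C(\mathcal X,\mathbb R^{n_1}\times\mathbb R^{n_2})$, $J=-J^\top$, $R=R^\top\succeq0$ pointwise, $E=\mathrm{diag}(E_{11},0)$ with $E_{11}\in C(\mathcal X,\mathbb R^{n_1,n_1})$ pointwise invertible, and $E^\top z=\nabla\mathcal H$ on $\mathcal X$ for a Hamiltonian $\mathcal H\in C^1(\mathcal X,\mathbb R)$. The specified Hamiltonian is $\mathcal H_1\in C^1(\mathcal X_1,\mathbb R)$ with $\mathcal H_1(x_1)=\mathcal H(x_1,x_2)$, $\nabla\mathcal H_1(x_1)=\nabla_{x_1}\mathcal H(x_1,x_2)$ (it exists). A discrete gradient of $f\in C^1(\mathcal Y,\mathbb R)$, $\mathcal Y\subseteq\mathbb R^d$ open, is $\overline\nabla f\in C(\mathcal Y\times\mathcal Y,\mathbb R^d)$ with $\overline\nabla f(x,x')^\top(x'-x)=f(x')-f(x)$ and $\overline\nabla f(x,x)=\nabla f(x)$. A continuous $\overline F$ on $\mathcal X\times\mathcal X$ is a consistent discretization of $F$ if $\overline F(x,x)=F(x)$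 for all $x$. $A^{-\top}=(A^{-1})^\top$. Below, barred functions without arguments are evaluated at $(x^k,x^{k+1})$. Semi-explicit discrete gradient method: with $\zeta=\begin{bmatrix}z_1^{k,k+1}\\ \overline z_2\end{bmatrix}$, $$\begin{bmatrix}\overline E_{11}&0\\0&0\end{bmatrix}(x^{k+1}-x^k)=h(\overline J-\overline R)\zeta+h\overline Bu^{k,k+1},\quad y^{k,k+1}=\overline B^\top\zeta,\quad\overline E_{11}^\top z_1^{k,k+1}=\overline\nabla\mathcal H_1(x_1^k,x_1^{k+1}).$$ Discrete gradient pair method: $$\overline E(x^{k+1}-x^k)=h(\overline J-\overline R)\overline z+h\overline Bu^{k,k+1},\qquad y^{k,k+1}=\overline B^\top\overline z.$$ *)

theory Defs
  imports "HOL-Analysis.Analysis"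
begin

section \<open>Block vectors and matrices\<close>

text \<open>
  A state in $\mathbb R^{n_1+n_2}$ is a vector indexed by the disjoint sum of the two index types.
\<close>

definition upper :: "real ^ ('p::finite + 'q::finite) \<Rightarrow> real ^ 'p" where
  "upper x = (\<chi> i. x $ Inl i)"

definition lower :: "real ^ ('p::finite + 'q::finite) \<Rightarrow> real ^ 'q" where
  "lower x = (\<chi> j. x $ Inr j)"

definition stack :: "real ^ 'p \<Rightarrow> real ^ 'q \<Rightarrow> real ^ ('p::finite + 'q::finite)" where
  "stack a b = (\<chi> i. case i of Inl k \<Rightarrow> a $ k | Inr k \<Rightarrow> b $ k)"

text \<open>The block matrix $\mathrm{diag}(A, 0)$.\<close>

definition diag_zero :: "real ^ 'p ^ 'p \<Rightarrow> real ^ ('p::finite + 'q::finite) ^ ('p::finite + 'q::finite)" where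
  "diag_zero A = (\<chi> i j. case i of
     Inl k \<Rightarrow> (case j of Inl l \<Rightarrow> A $ k $ l | Inr _ \<Rightarrow> 0)
   | Inr _ \<Rightarrow> 0)"

definition state_space :: "(real ^ 'p) set \<Rightarrow> (real ^ 'q) set \<Rightarrow> (real ^ ('p::finite + 'q::finite)) set" where
  "state_space X1 X2 = {x. upper x \<in> X1 \<and> lower x \<in> X2}"

definition skew_symmetric :: "real ^ 'n ^ 'n \<Rightarrow> bool" where
  "skew_symmetric A \<longleftrightarrow> A = - transpose A"

definition sym_pos_semidef :: "real ^ 'n ^ 'n \<Rightarrow> bool" where
  "sym_pos_semidef A \<longleftrightarrow> A = transpose A \<and> (\<forall>v. 0 \<le> v \<bullet> (A *v v))"


section \<open>Gradients\<close>

text \<open>Only meaningful where \<open>f\<close> is differentiable; the gradient is then unique.\<close>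

definition grad :: "('a::real_inner \<Rightarrow> real) \<Rightarrow> 'a \<Rightarrow> 'a" where
  "grad f x = (THE D. GDERIV f x :> D)"

lemma grad_eqI:
  assumes "GDERIV f x :> D"
  shows "grad f x = D"
  unfolding grad_def
proof (rule the_equality)
  fix D' assume "GDERIV f x :> D'"
  with assms have "(\<lambda>h. h \<bullet> D') = (\<lambda>h. h \<bullet> D)"
    unfolding gderiv_def by (metis has_derivative_unique)
  then have "(D' - D) \<bullet> (D' - D) = 0"
    by (metis inner_diff_right diff_self)
  then show "D' = D" by simp
qed (fact assms)

definition C1_on :: "'a::real_inner set \<Rightarrow> ('a \<Rightarrow> real) \<Rightarrow> bool" where
  "C1_on S f \<longleftrightarrow> (\<forall>x\<in>S. \<exists>D. GDERIV f x :> D) \<and> continuous_on S (grad f)"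


section \<open>Semi-explicit port-Hamiltonian DAEs\<close>

text \<open>
  The coefficients of
  $E(x)\dot x = (J(x)-R(x))z(x) + B(x)u$, $y = B(x)^\top z(x)$ with $E = \mathrm{diag}(E_{11},0)$.
\<close>

definition semi_explicit_pHDAE ::
  "(real ^ 'p) set \<Rightarrow> (real ^ 'q) set \<Rightarrow>
   (real ^ ('p::finite + 'q::finite) \<Rightarrow> real ^ 'p ^ 'p) \<Rightarrow>
   (real ^ ('p::finite + 'q::finite) \<Rightarrow> real ^ ('p::finite + 'q::finite) ^ ('p::finite + 'q::finite)) \<Rightarrow>
   (real ^ ('p::finite + 'q::finite) \<Rightarrow> real ^ ('p::finite + 'q::finite) ^ ('p::finite + 'q::finite)) \<Rightarrow>
   (real ^ ('p::finite + 'q::finite) \<Rightarrow> real ^ 'm ^ ('p::finite + 'q::finite)) \<Rightarrow>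
   (real ^ ('p::finite + 'q::finite) \<Rightarrow> real ^ ('p::finite + 'q::finite)) \<Rightarrow>
   (real ^ ('p::finite + 'q::finite) \<Rightarrow> real) \<Rightarrow> bool" where
  "semi_explicit_pHDAE X1 X2 E11 J R B z H \<longleftrightarrow>
     open X1 \<and> open X2 \<and> convex X2 \<and>
     continuous_on (state_space X1 X2) E11 \<and>
     continuous_on (state_space X1 X2) J \<and>
     continuous_on (state_space X1 X2) R \<and>
     continuous_on (state_space X1 X2) B \<and>
     continuous_on (state_space X1 X2) z \<and>
     C1_on (state_space X1 X2) H \<and>
     (\<forall>x \<in> state_space X1 X2.
        invertible (E11 x) \<and> skew_symmetric (J x) \<and> sym_pos_semidef (R x) \<and>
        transpose (diag_zero (E11 x)) *v z x = grad H x)"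

text \<open>
  \<open>grad (\<lambda>a. H (stack a x2)) x1\<close> is the partial gradient $\nabla_{x_1}\mathcal H(x_1,x_2)$.
\<close>

definition specified_hamiltonian ::
  "(real ^ 'p) set \<Rightarrow> (real ^ 'q) set \<Rightarrow> (real ^ ('p::finite + 'q::finite) \<Rightarrow> real) \<Rightarrow>
   (real ^ 'p \<Rightarrow> real) \<Rightarrow> bool" where
  "specified_hamiltonian X1 X2 H H1 \<longleftrightarrow>
     C1_on X1 H1 \<and>
     (\<forall>x1\<in>X1. \<forall>x2\<in>X2. H1 x1 = H (stack x1 x2) \<and>
        grad H1 x1 = grad (\<lambda>a. H (stack a x2)) x1)"


section \<open>Discretizations\<close>

definition discrete_gradient ::
  "'a::real_inner set \<Rightarrow> ('a \<Rightarrow> real) \<Rightarrow> ('a \<Rightarrow> 'a \<Rightarrow> 'a) \<Rightarrow> bool" where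
  "discrete_gradient Y f DG \<longleftrightarrow>
     continuous_on (Y \<times> Y) (\<lambda>(x, x'). DG x x') \<and>
     (\<forall>x\<in>Y. \<forall>x'\<in>Y. DG x x' \<bullet> (x' - x) = f x' - f x) \<and>
     (\<forall>x\<in>Y. DG x x = grad f x)"

definition consistent_discretization ::
  "'a::topological_space set \<Rightarrow> ('a \<Rightarrow> 'b::topological_space) \<Rightarrow> ('a \<Rightarrow> 'a \<Rightarrow> 'b) \<Rightarrow> bool" where
  "consistent_discretization X F Fb \<longleftrightarrow>
     continuous_on (X \<times> X) (\<lambda>(x, x'). Fb x x') \<and> (\<forall>x\<in>X. Fb x x = F x)"

text \<open>
  One step of the two methods, from \<open>xk\<close> to \<open>xk'\<close> with step size \<open>h\<close>, input \<open>u\<close> and output \<open>y\<close>.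
  In the first one, \<open>z1\<close> is the additional unknown $z_1^{k,k+1}$.
\<close>

definition semi_explicit_discrete_gradient_step ::
  "(real ^ ('p::finite + 'q::finite) \<Rightarrow> real ^ ('p::finite + 'q::finite) \<Rightarrow> real ^ 'p ^ 'p) \<Rightarrow>
   (real ^ ('p::finite + 'q::finite) \<Rightarrow> real ^ ('p::finite + 'q::finite) \<Rightarrow> real ^ ('p::finite + 'q::finite) ^ ('p::finite + 'q::finite)) \<Rightarrow>
   (real ^ ('p::finite + 'q::finite) \<Rightarrow> real ^ ('p::finite + 'q::finite) \<Rightarrow> real ^ ('p::finite + 'q::finite) ^ ('p::finite + 'q::finite)) \<Rightarrow>
   (real ^ ('p::finite + 'q::finite) \<Rightarrow> real ^ ('p::finite + 'q::finite) \<Rightarrow> real ^ 'm ^ ('p::finite + 'q::finite)) \<Rightarrow>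
   (real ^ ('p::finite + 'q::finite) \<Rightarrow> real ^ ('p::finite + 'q::finite) \<Rightarrow> real ^ 'q) \<Rightarrow>
   (real ^ 'p \<Rightarrow> real ^ 'p \<Rightarrow> real ^ 'p) \<Rightarrow>
   real \<Rightarrow> real ^ ('p::finite + 'q::finite) \<Rightarrow> real ^ ('p::finite + 'q::finite) \<Rightarrow> real ^ 'm \<Rightarrow> real ^ 'm \<Rightarrow> real ^ 'p \<Rightarrow> bool" where
  "semi_explicit_discrete_gradient_step E11b Jb Rb Bb z2b DG h xk xk' u y z1 \<longleftrightarrow>
     (let \<zeta> = stack z1 (z2b xk xk') in
      diag_zero (E11b xk xk') *v (xk' - xk) =
        h *\<^sub>R ((Jb xk xk' - Rb xk xk') *v \<zeta>) + h *\<^sub>R (Bb xk xk' *v u) \<and>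
      y = transpose (Bb xk xk') *v \<zeta> \<and>
      transpose (E11b xk xk') *v z1 = DG (upper xk) (upper xk'))"

definition discrete_gradient_pair_step ::
  "(real ^ 'n \<Rightarrow> real ^ 'n \<Rightarrow> real ^ 'n ^ 'n) \<Rightarrow>
   (real ^ 'n \<Rightarrow> real ^ 'n \<Rightarrow> real ^ 'n) \<Rightarrow>
   (real ^ 'n \<Rightarrow> real ^ 'n \<Rightarrow> real ^ 'n ^ 'n) \<Rightarrow>
   (real ^ 'n \<Rightarrow> real ^ 'n \<Rightarrow> real ^ 'n ^ 'n) \<Rightarrow>
   (real ^ 'n \<Rightarrow> real ^ 'n \<Rightarrow> real ^ 'm ^ 'n) \<Rightarrow>
   real \<Rightarrow> real ^ 'n \<Rightarrow> real ^ 'n \<Rightarrow> real ^ 'm \<Rightarrow> real ^ 'm \<Rightarrow> bool" where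
  "discrete_gradient_pair_step Eb zb Jb Rb Bb h xk xk' u y \<longleftrightarrow>
     Eb xk xk' *v (xk' - xk) =
       h *\<^sub>R ((Jb xk xk' - Rb xk xk') *v zb xk xk') + h *\<^sub>R (Bb xk xk' *v u) \<and>
     y = transpose (Bb xk xk') *v zb xk xk'"

end

theory Submission
  imports Defs
begin

text \<open>Since the discretized \<open>E11b\<close> is invertible at the pair of states, so is its
  transpose, and the last equation of the semi-explicit step has exactly one solution
  \<open>z1\<close>: the discrete gradient multiplied by the inverse transpose. That is the upper
  block of \<open>zb\<close>, so substituting it turns \<zeta> into \<open>zb\<close> and the two
  remaining equations into those of the pair method. \<open>transpose_mult_vec_eq_iff\<close>
  supplies this unique solvability.\<close>

lemma transpose_mult_vec_eq_iff:
  fixes A :: "real ^ 'n ^ 'n"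
  assumes "invertible A"
  shows "transpose A *v v = w \<longleftrightarrow> v = transpose (matrix_inv A) *v w"
proof -
  \<comment> \<open>\<open>matrix_inv\<close> is a Hilbert choice, so its two-sided inverse property
    comes from the existence of some inverse.\<close>
  have "A ** matrix_inv A = mat 1 \<and> matrix_inv A ** A = mat 1"
    using assms unfolding invertible_def matrix_inv_def by (rule someI_ex)
  then have "transpose (matrix_inv A) ** transpose A = mat 1"
    and "transpose A ** transpose (matrix_inv A) = mat 1"
    by (simp_all flip: matrix_transpose_mul)
  then show ?thesis
    \<comment> \<open>Each direction multiplies the given equation by one of the two factors and
      cancels; hence both product identities.\<close>
    by (metis matrix_vector_mul_assoc matrix_vector_mul_lid)
qed

theorem corollary5p2:
  fixes X1 :: "(real ^ 'p) set" and X2 :: "(real ^ 'q) set"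
    and X :: "(real ^ ('p::finite + 'q::finite)) set"
    and E11 :: "real ^ ('p::finite + 'q::finite) \<Rightarrow> real ^ 'p ^ 'p"
    and J R :: "real ^ ('p + 'q) \<Rightarrow> real ^ ('p + 'q) ^ ('p + 'q)"
    and B :: "real ^ ('p + 'q) \<Rightarrow> real ^ 'm ^ ('p + 'q)"
    and z :: "real ^ ('p + 'q) \<Rightarrow> real ^ ('p + 'q)"
    and H :: "real ^ ('p + 'q) \<Rightarrow> real" and H1 :: "real ^ 'p \<Rightarrow> real"
    and E11b :: "real ^ ('p + 'q) \<Rightarrow> real ^ ('p + 'q) \<Rightarrow> real ^ 'p ^ 'p"
    and z2b :: "real ^ ('p + 'q) \<Rightarrow> real ^ ('p + 'q) \<Rightarrow> real ^ 'q"
    and DH1 :: "real ^ 'p \<Rightarrow> real ^ 'p \<Rightarrow> real ^ 'p"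
    and Eb Jb Rb :: "real ^ ('p + 'q) \<Rightarrow> real ^ ('p + 'q) \<Rightarrow> real ^ ('p + 'q) ^ ('p + 'q)"
    and zb :: "real ^ ('p + 'q) \<Rightarrow> real ^ ('p + 'q) \<Rightarrow> real ^ ('p + 'q)"
    and Bb :: "real ^ ('p + 'q) \<Rightarrow> real ^ ('p + 'q) \<Rightarrow> real ^ 'm ^ ('p + 'q)"
  assumes "X = state_space X1 X2"
    and "semi_explicit_pHDAE X1 X2 E11 J R B z H"
    and "specified_hamiltonian X1 X2 H H1"
    and "consistent_discretization X E11 E11b"
    and "consistent_discretization X (\<lambda>x. lower (z x)) z2b"
    and "\<forall>x\<in>X. \<forall>x'\<in>X. invertible (E11b x x')"
    and "discrete_gradient X1 H1 DH1"
    and "\<forall>x\<in>X. \<forall>x'\<in>X. Eb x x' = diag_zero (E11b x x')"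
    and "\<forall>x\<in>X. \<forall>x'\<in>X. zb x x' =
           stack (transpose (matrix_inv (E11b x x')) *v DH1 (upper x) (upper x')) (z2b x x')"
    and "consistent_discretization X J Jb"
    and "consistent_discretization X R Rb"
    and "consistent_discretization X B Bb"
    and "\<forall>x\<in>X. \<forall>x'\<in>X. skew_symmetric (Jb x x')"
    and "\<forall>x\<in>X. \<forall>x'\<in>X. sym_pos_semidef (Rb x x')"
  shows "\<forall>h>0. \<forall>xk\<in>X. \<forall>xk'\<in>X. \<forall>u y.
    (\<exists>z1. semi_explicit_discrete_gradient_step E11b Jb Rb Bb z2b DH1 h xk xk' u y z1)
      \<longleftrightarrow> discrete_gradient_pair_step Eb zb Jb Rb Bb h xk xk' u y"
  \<comment> \<open>Once the last equation reads \<open>z1 = ...\<close>, the one-point rule removes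
    the existential. The simp rule \<open>transpose_matrix_vector\<close> is disabled because it
    would rewrite \<open>transpose A *v v\<close> to \<open>v v* A\<close>, hiding the left-hand
    side of the lemma.\<close>
  using assms(6,8,9)
  by (simp add: semi_explicit_discrete_gradient_step_def discrete_gradient_pair_step_def
      Let_def transpose_mult_vec_eq_iff
      del: transpose_matrix_vector)

end
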